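(* Let $\mathcal H$ be a real Hilbert space, let $f\in\Gamma_0(\mathcal H)$ and suppose $\operatorname{int}\operatorname{dom} f^*\neq\varnothing$. Then the following are equivalent: (i) $f$ is almost strictly convex. (ii) $f^*$ is Gâteaux differentiable on the open convex set $\operatorname{int}\operatorname{dom} f^*$, and $\partial f^*(x)=\varnothing$ for every $x\in\mathcal H\setminus(\operatorname{int}\operatorname{dom} f^* )$. Moreover, these conditions imply $\operatorname{dom}\partial f=\nabla f^*(\operatorname{int}\operatorname{dom} f^* )$ and $\operatorname{ran}\partial f=\operatorname{int}\operatorname{dom} f^*$.
   Context: $\Gamma_0(\mathcal H)$ is the set of proper, lower semicontinuous, convex functions $f:\mathcal H\to\left]-\infty,+\infty\right]$; $\operatorname{dom} f=\{x: f(x)<+\infty\}$. The subdifferential is $\partial f(x)=\{v\in\mathcal H : f(y)\ge f(x)+\langle v,y-x\rangle\ \forall y\in\mathcal H\}$, with $\operatorname{dom}\partial f=\{x:\partial f(x)\neq\varnothing\}$ and $\operatorname{ran}\partial f=\bigcup_x\partial f(x)$. The Fenchel conjugate is $f^*(v)=\sup_{x\in\mathcal H}(\langle x,v\rangle-f(x))$, and $\nabla f^*$ denotes the Gâteaux gradient. $f\in\Gamma_0(\mathcal H)$ is almost strictly convex if it is strictly convex along every line segment contained in $\operatorname{dom}\partial f$. *)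

theory Defs
  imports "HOL-Analysis.Analysis"
begin

definition edom :: "('h \<Rightarrow> ereal) \<Rightarrow> 'h set" where
  "edom f = {x. f x < \<infinity>}"

definition proper :: "('h \<Rightarrow> ereal) \<Rightarrow> bool" where
  "proper f \<longleftrightarrow> (\<forall>x. f x \<noteq> - \<infinity>) \<and> edom f \<noteq> {}"

definition lower_semicontinuous :: "('h::topological_space \<Rightarrow> ereal) \<Rightarrow> bool" where
  "lower_semicontinuous f \<longleftrightarrow> (\<forall>x. f x \<le> Liminf (nhds x) f)"

text \<open>Both inequalities below are meant for functions that omit the value \<open>- \<infinity>\<close>, so that
  the right-hand sides never have the form \<open>\<infinity> - \<infinity>\<close>.\<close>

definition econvex :: "('h::real_vector \<Rightarrow> ereal) \<Rightarrow> bool" where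
  "econvex f \<longleftrightarrow> (\<forall>x y. \<forall>t::real. 0 < t \<and> t < 1 \<longrightarrow>
     f ((1 - t) *\<^sub>R x + t *\<^sub>R y) \<le> ereal (1 - t) * f x + ereal t * f y)"

definition strictly_convex_on :: "'h::real_vector set \<Rightarrow> ('h \<Rightarrow> ereal) \<Rightarrow> bool" where
  "strictly_convex_on C f \<longleftrightarrow> (\<forall>x\<in>C. \<forall>y\<in>C. \<forall>t::real. x \<noteq> y \<and> 0 < t \<and> t < 1 \<longrightarrow>
     f ((1 - t) *\<^sub>R x + t *\<^sub>R y) < ereal (1 - t) * f x + ereal t * f y)"

definition Gamma0 :: "('h::real_inner \<Rightarrow> ereal) set" where
  "Gamma0 = {f. proper f \<and> lower_semicontinuous f \<and> econvex f}"

definition subdifferential :: "('h::real_inner \<Rightarrow> ereal) \<Rightarrow> 'h \<Rightarrow> 'h set" where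
  "subdifferential f x = {v. \<forall>y. f y \<ge> f x + ereal (v \<bullet> (y - x))}"

definition dom_subdifferential :: "('h::real_inner \<Rightarrow> ereal) \<Rightarrow> 'h set" where
  "dom_subdifferential f = {x. subdifferential f x \<noteq> {}}"

definition ran_subdifferential :: "('h::real_inner \<Rightarrow> ereal) \<Rightarrow> 'h set" where
  "ran_subdifferential f = (\<Union>x. subdifferential f x)"

definition fenchel_conjugate :: "('h::real_inner \<Rightarrow> ereal) \<Rightarrow> 'h \<Rightarrow> ereal" where
  "fenchel_conjugate f v = (SUP x. ereal (x \<bullet> v) - f x)"

definition almost_strictly_convex :: "('h::real_inner \<Rightarrow> ereal) \<Rightarrow> bool" where
  "almost_strictly_convex f \<longleftrightarrow>
     (\<forall>a b. closed_segment a b \<subseteq> dom_subdifferential f \<longrightarrow> strictly_convex_on (closed_segment a b) f)"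

text \<open>The difference quotients are taken in the extended reals. As \<open>g x\<close> and all the limits are
  finite, \<open>g\<close> is automatically finite at \<open>x + \<alpha> y\<close> for all small \<open>\<alpha> > 0\<close>.\<close>

definition has_gateaux_derivative ::
    "('h::real_inner \<Rightarrow> ereal) \<Rightarrow> ('h \<Rightarrow> real) \<Rightarrow> 'h \<Rightarrow> bool" where
  "has_gateaux_derivative g D x \<longleftrightarrow> \<bar>g x\<bar> \<noteq> \<infinity> \<and> bounded_linear D \<and>
     (\<forall>y. ((\<lambda>\<alpha>::real. (g (x + \<alpha> *\<^sub>R y) - g x) / ereal \<alpha>) \<longlongrightarrow> ereal (D y)) (at_right 0))"

definition gateaux_differentiable :: "('h::real_inner \<Rightarrow> ereal) \<Rightarrow> 'h \<Rightarrow> bool" where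
  "gateaux_differentiable g x \<longleftrightarrow> (\<exists>D. has_gateaux_derivative g D x)"

text \<open>The gradient is the Riesz representer of the Gateaux derivative.\<close>

definition gateaux_gradient :: "('h::real_inner \<Rightarrow> ereal) \<Rightarrow> 'h \<Rightarrow> 'h" where
  "gateaux_gradient g x = (THE u. has_gateaux_derivative g (\<lambda>y. y \<bullet> u) x)"

lemma convex_edom_fenchel_conjugate:
  fixes f :: "'h::real_inner \<Rightarrow> ereal"
  assumes "proper f"
  shows "convex (edom (fenchel_conjugate f))"
  unfolding convex_alt
proof (intro ballI allI impI)
  fix v w and t :: real
  assume v: "v \<in> edom (fenchel_conjugate f)" and w: "w \<in> edom (fenchel_conjugate f)"
    and t: "0 \<le> t \<and> t \<le> 1"
  obtain a where a: "fenchel_conjugate f v \<le> ereal a"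
    using v unfolding edom_def by (cases "fenchel_conjugate f v") auto
  obtain b where b: "fenchel_conjugate f w \<le> ereal b"
    using w unfolding edom_def by (cases "fenchel_conjugate f w") auto
  have "ereal (x \<bullet> ((1 - t) *\<^sub>R v + t *\<^sub>R w)) - f x \<le> ereal ((1 - t) * a + t * b)" for x
  proof (cases "f x")
    case (real r)
    have "ereal (x \<bullet> v) - f x \<le> ereal a" "ereal (x \<bullet> w) - f x \<le> ereal b"
      using a b unfolding fenchel_conjugate_def by (simp_all add: SUP_le_iff)
    hence "x \<bullet> v - r \<le> a" "x \<bullet> w - r \<le> b" by (simp_all add: real)
    hence "(1 - t) * (x \<bullet> v - r) + t * (x \<bullet> w - r) \<le> (1 - t) * a + t * b"
      using t by (intro add_mono mult_left_mono) auto
    thus ?thesis by (simp add: real inner_add_right algebra_simps)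
  qed (use assms in \<open>auto simp: proper_def\<close>)
  hence "fenchel_conjugate f ((1 - t) *\<^sub>R v + t *\<^sub>R w) \<le> ereal ((1 - t) * a + t * b)"
    unfolding fenchel_conjugate_def by (simp add: SUP_le_iff)
  thus "(1 - t) *\<^sub>R v + t *\<^sub>R w \<in> edom (fenchel_conjugate f)"
    unfolding edom_def by (metis ereal_less(4) le_less_trans less_ereal.simps(4) mem_Collect_eq)
qed

lemma open_convex_interior_edom_fenchel_conjugate:
  assumes "proper f"
  shows "open (interior (edom (fenchel_conjugate f)))"
    and "convex (interior (edom (fenchel_conjugate f)))"
  using convex_edom_fenchel_conjugate[OF assms] by (simp_all add: convex_interior)

end

theory Submission
  imports Defs
begin

text \<open>Strict convexity of \<open>f\<close> along segments in \<open>dom \<partial>f\<close> means that no \<open>u\<close> is a subgradient at two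
  different points, i.e. that \<open>\<partial>f\<^sup>* = (\<partial>f)\<^sup>-\<^sup>1\<close> is at most single-valued. On the interior of
  \<open>dom f\<^sup>*\<close> the directional derivatives of \<open>f\<^sup>*\<close> are maxima over \<open>\<partial>f\<^sup>*(u)\<close>, so single-valuedness
  is Gateaux differentiability there; at any other point a supporting functional of \<open>dom f\<^sup>*\<close> can be
  added to a subgradient, so a subdifferential with at most one element must be empty. Weak compactness
  enters only in the form that nested bounded closed convex sets in a Hilbert space meet.\<close>

section \<open>Nested convex sets, projections and supporting functionals in a Hilbert space\<close>

text \<open>Each \<open>K n\<close> is cut down to its points of norm at most
  \<open>D + 1 / Suc n\<close>, where \<open>D\<close> is the limit of the distances
  \<open>d n\<close> of the sets from 0. The diameters of these slices tend to 0, so Cantor's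
  intersection theorem applies.\<close>

lemma nested_closed_convex_bounded_meet:
  fixes K :: "nat \<Rightarrow> 'h::{real_inner, complete_space} set"
  assumes closed: "\<And>n. closed (K n)" and convex: "\<And>n. convex (K n)"
    and nonempty: "\<And>n. K n \<noteq> {}" and dec: "\<And>m n. m \<le> n \<Longrightarrow> K n \<subseteq> K m"
    and bounded: "bounded (K 0)"
  obtains a where "\<And>n. a \<in> K n"
proof -
  define d where "d n = (INF x\<in>K n. norm x)" for n
  define D where "D = (SUP n. d n)"
  have bdd: "bdd_below (norm ` K n)" for n
    by (rule bdd_belowI2[of _ 0]) simp
  have d_le: "d n \<le> norm x" if "x \<in> K n" for n x
    unfolding d_def using bdd that by (rule cINF_lower)
  have d_nonneg: "0 \<le> d n" for n
    unfolding d_def by (rule cINF_greatest[OF nonempty]) simp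
  have "incseq d"
    unfolding d_def by (intro incseq_SucI cINF_superset_mono nonempty bdd dec) auto
  obtain R where R: "\<And>x. x \<in> K 0 \<Longrightarrow> norm x \<le> R"
    using bounded by (auto simp: bounded_iff)
  have "d n \<le> R" for n
  proof -
    obtain x where "x \<in> K n" using nonempty by blast
    then show ?thesis using d_le[of x n] R[of x] dec[of 0 n] by auto
  qed
  then have bdd_d: "bdd_above (range d)"
    by (intro bdd_aboveI2)
  then have lim: "d \<longlonglongrightarrow> D"
    unfolding D_def using \<open>incseq d\<close> by (rule LIMSEQ_incseq_SUP)
  have d_le_D: "d n \<le> D" for n
    unfolding D_def using bdd_d by (intro cSUP_upper) auto
  define L where "L n = K n \<inter> cball 0 (D + 1 / Suc n)" for n
  have L_nonempty: "L n \<noteq> {}" for n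
  proof -
    have "d n < D + 1 / Suc n" using d_le_D[of n]
      by (smt (verit) divide_pos_pos of_nat_0_less_iff zero_less_Suc zero_less_one)
    then obtain x where "x \<in> K n" "norm x < D + 1 / Suc n"
      unfolding d_def using cINF_less_iff[OF nonempty bdd] by blast
    then show ?thesis by (auto simp: L_def)
  qed
  have L_closed: "closed (L n)" for n
    unfolding L_def by (intro closed_Int closed closed_cball)
  have L_dec: "L n \<subseteq> L m" if "m \<le> n" for m n
  proof -
    have "1 / real (Suc n) \<le> 1 / real (Suc m)"
      using that by (intro divide_left_mono) auto
    then show ?thesis using dec[OF that] by (auto simp: L_def)
  qed
  have diam: "(dist x y)\<^sup>2 \<le> 4 * ((D + 1 / Suc n)\<^sup>2 - (d n)\<^sup>2)" if "x \<in> L n" "y \<in> L n" for x y n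
  proof -
    \<comment> \<open>The midpoint stays in the convex set \<open>K n\<close>, so its norm is at
      least \<open>d n\<close>; the parallelogram identity turns this into a bound on
      \<open>dist x y\<close>.\<close>
    have "(1/2) *\<^sub>R x + (1/2) *\<^sub>R y \<in> K n"
      using that by (intro convexD[OF convex]) (auto simp: L_def)
    then have "d n \<le> norm ((1/2) *\<^sub>R x + (1/2) *\<^sub>R y)"
      by (rule d_le)
    then have "(d n)\<^sup>2 \<le> (norm ((1/2) *\<^sub>R x + (1/2) *\<^sub>R y))\<^sup>2"
      using d_nonneg by (intro power_mono) auto
    moreover have "(norm x)\<^sup>2 \<le> (D + 1 / Suc n)\<^sup>2" "(norm y)\<^sup>2 \<le> (D + 1 / Suc n)\<^sup>2"
      using that by (auto simp: L_def intro!: power_mono)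
    moreover have "(dist x y)\<^sup>2 = 2 * (norm x)\<^sup>2 + 2 * (norm y)\<^sup>2
        - 4 * (norm ((1/2) *\<^sub>R x + (1/2) *\<^sub>R y))\<^sup>2"
      unfolding dist_norm power2_norm_eq_inner
      by (simp add: algebra_simps inner_commute)
    ultimately show ?thesis by simp
  qed
  have "(\<lambda>n. 4 * ((D + 1 / Suc n)\<^sup>2 - (d n)\<^sup>2)) \<longlonglongrightarrow> 4 * ((D + 0)\<^sup>2 - D\<^sup>2)"
    by (intro tendsto_intros lim LIMSEQ_Suc[OF lim_1_over_n])
  then have tend: "(\<lambda>n. 4 * ((D + 1 / Suc n)\<^sup>2 - (d n)\<^sup>2)) \<longlonglongrightarrow> 0"
    by simp
  have small: "\<exists>n. 4 * ((D + 1 / Suc n)\<^sup>2 - (d n)\<^sup>2) < \<epsilon>\<^sup>2" if "\<epsilon> > 0" for \<epsilon> :: real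
    using order_tendstoD(2)[OF tend, of "\<epsilon>\<^sup>2"] that
    unfolding eventually_sequentially by (meson order_refl zero_less_power)
  have "\<exists>n. \<forall>x\<in>L n. \<forall>y\<in>L n. dist x y < \<epsilon>" if "\<epsilon> > 0" for \<epsilon>
    using small[OF that] diam that by (meson le_less_trans less_imp_le power2_less_imp_less)
  from decreasing_closed_nest[OF L_closed L_nonempty L_dec this]
  obtain a where "\<And>n. a \<in> L n" by blast
  then show ?thesis using that by (auto simp: L_def)
qed

text \<open>The points of \<open>C\<close> at distance at most
  \<open>infdist z C + 1 / Suc n\<close> from \<open>z\<close> form nested bounded closed convex
  sets; a common point attains the distance.\<close>

lemma closest_point_exists_hilbert:
  fixes C :: "'h::{real_inner, complete_space} set"
  assumes "closed C" "convex C" "C \<noteq> {}"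
  obtains p where "p \<in> C" "\<And>y. y \<in> C \<Longrightarrow> dist z p \<le> dist z y"
proof -
  define K where "K n = C \<inter> cball z (infdist z C + 1 / Suc n)" for n
  have "K n \<noteq> {}" for n
  proof -
    have "(INF y\<in>C. dist z y) < infdist z C + 1 / Suc n"
      using assms(3) by (simp add: infdist_def)
    then obtain y where "y \<in> C" "dist z y < infdist z C + 1 / Suc n"
      using cINF_less_iff[OF assms(3), of "dist z"] by auto
    then show ?thesis by (auto simp: K_def)
  qed
  moreover have "K n \<subseteq> K m" if "m \<le> n" for m n
  proof -
    have "1 / real (Suc n) \<le> 1 / real (Suc m)"
      using that by (intro divide_left_mono) auto
    then show ?thesis by (auto simp: K_def)
  qed
  moreover have "closed (K n)" "convex (K n)" for n
    using assms by (auto simp: K_def intro!: closed_Int convex_Int)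
  moreover have "bounded (K 0)"
    by (simp add: K_def bounded_Int)
  ultimately obtain p where p: "\<And>n. p \<in> K n"
    using nested_closed_convex_bounded_meet[of K] by blast
  have "(\<lambda>n. infdist z C + 1 / Suc n) \<longlonglongrightarrow> infdist z C + 0"
    by (intro tendsto_intros LIMSEQ_Suc[OF lim_1_over_n])
  moreover have "\<forall>n. dist z p \<le> infdist z C + 1 / Suc n"
    using p by (auto simp: K_def)
  ultimately have "dist z p \<le> infdist z C"
    using LIMSEQ_le_const by fastforce
  then show ?thesis
    using that[of p] p infdist_le[of _ C z] by (fastforce simp: K_def)
qed

text \<open>An instance of the uniform boundedness principle: the closed sets \<open>E n\<close>
  cover the space, so by Baire one of them contains a ball, and moving from its centre in the
  direction of \<open>x\<close> bounds \<open>norm x\<close>.\<close>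

lemma bounded_if_inner_bounded_above:
  fixes S :: "'h::{real_inner, complete_space} set"
  assumes "\<And>v. \<exists>M. \<forall>x\<in>S. x \<bullet> v \<le> M"
  shows "bounded S"
proof -
  define E where "E n = {v. \<forall>x\<in>S. x \<bullet> v \<le> real n}" for n :: nat
  have "E n = (\<Inter>x\<in>S. {v. x \<bullet> v \<le> real n})" for n
    by (auto simp: E_def)
  then have closed: "closed (E n)" for n
    by (auto intro!: closed_INT closed_Collect_le continuous_intros)
  have "\<exists>n. v \<in> E n" for v
  proof -
    obtain M where "\<forall>x\<in>S. x \<bullet> v \<le> M" using assms by blast
    moreover obtain n where "M \<le> real n" using real_arch_simple by blast
    ultimately show ?thesis
      by (intro exI[of _ n]) (fastforce simp: E_def)
  qed
  then have cover: "\<Union>(range E) = UNIV" by blast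
  have "\<exists>n. interior (E n) \<noteq> {}"
  proof (rule ccontr)
    assume "\<nexists>n. interior (E n) \<noteq> {}"
    then have "Met_TC.mtopology interior_of \<Union>(range E) = {}"
      using closed
      by (intro Met_TC.metric_Baire_category_alt) (auto simp: complete_UNIV)
    then show False using cover by simp
  qed
  then obtain n v r where r: "r > 0" "cball v r \<subseteq> E n"
    by (metis ex_in_conv mem_interior_cball)
  \<comment> \<open>An upper bound in direction \<open>- v\<close> bounds
    \<open>x \<bullet> v\<close> from below, which removes the contribution of the centre
    \<open>v\<close>.\<close>
  obtain M where M: "\<forall>x\<in>S. x \<bullet> (- v) \<le> M" using assms by blast
  have "norm x \<le> (n + M) / r" if "x \<in> S" for x
  proof -
    \<comment> \<open>For \<open>x = 0\<close> the quotient is 0 and the point is \<open>v\<close>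
      itself, so this case needs no separate treatment.\<close>
    have "v + (r / norm x) *\<^sub>R x \<in> cball v r"
      using r by (simp add: dist_norm)
    then have "x \<bullet> (v + (r / norm x) *\<^sub>R x) \<le> n"
      using r that by (auto simp: E_def)
    moreover have "x \<bullet> ((r / norm x) *\<^sub>R x) = r * norm x"
      by (simp add: power2_norm_eq_inner[symmetric] power2_eq_square)
    ultimately have "r * norm x \<le> n + M"
      using M that by (auto simp: inner_add_right)
    then show ?thesis using r by (simp add: field_simps)
  qed
  then show ?thesis by (auto simp: bounded_iff)
qed

text \<open>The point \<open>x\<close> is approximated from outside the closure by \<open>x\<^sub>n = c + (1 + 1/n) (x - c)\<close>.
  The functionals separating \<open>x\<^sub>n\<close> from \<open>C\<close> are normalised to take the value \<open>1\<close> at \<open>x\<^sub>n - c\<close>;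
  as \<open>C\<close> contains a ball around \<open>c\<close>, they are uniformly bounded.\<close>

lemma supporting_functional_convex:
  fixes C :: "'h::{real_inner, complete_space} set"
  assumes "convex C" "interior C \<noteq> {}" "x \<notin> interior C"
  obtains w where "w \<noteq> 0" "\<And>v. v \<in> C \<Longrightarrow> w \<bullet> v \<le> w \<bullet> x"
proof -
  obtain c r where r: "r > 0" "cball c r \<subseteq> C"
    using assms(2) by (metis ex_in_conv mem_interior_cball)
  have "c \<in> C" using r by auto
  \<comment> \<open>With \<open>k = Suc n\<close>, a functional equal to 1 at
    \<open>(1 + 1 / k) *\<^sub>R (x - c)\<close> takes the value \<open>1 - 1 / (k + 1)\<close> at
    \<open>x - c\<close>; this is the lower bound. A common point \<open>w\<close> of all
    \<open>K n\<close> then satisfies \<open>w \<bullet> (x - c) \<ge> 1\<close>.\<close>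
  define K where "K n = {w. (\<forall>v\<in>C. w \<bullet> (v - c) \<le> 1) \<and> 1 - 1 / Suc (Suc n) \<le> w \<bullet> (x - c)}" for n
  have nonempty: "K n \<noteq> {}" for n
  proof -
    define k where "k = real (Suc n)"
    define z where "z = x + (1 / k) *\<^sub>R (x - c)"
    have k: "k > 0" by (simp add: k_def)
    have "z \<notin> closure C"
    proof
      assume "z \<in> closure C"
      then obtain y where y: "y \<in> C" "dist y z < r / k"
        using k r closure_approachable by (meson divide_pos_pos)
      \<comment> \<open>The point \<open>x\<close> lies strictly between \<open>c\<close> and
        \<open>z\<close>. So every \<open>x'\<close> near \<open>x\<close> is a convex combination
        of \<open>y\<close> and a point \<open>b\<close> of the ball around \<open>c\<close>, and
        \<open>x\<close> would be interior to \<open>C\<close>.\<close>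
      have "ball x ((r - k * dist y z) / (k + 1)) \<subseteq> C"
      proof
        fix x' assume x': "x' \<in> ball x ((r - k * dist y z) / (k + 1))"
        define b where "b = (k + 1) *\<^sub>R x' - k *\<^sub>R y"
        have "b - c = (k + 1) *\<^sub>R (x' - x) - k *\<^sub>R (y - z)"
          using k by (simp add: b_def z_def algebra_simps)
        then have "norm (b - c) \<le> (k + 1) * norm (x' - x) + k * norm (y - z)"
          using k norm_triangle_ineq4[of "(k + 1) *\<^sub>R (x' - x)" "k *\<^sub>R (y - z)"] by simp
        also have "\<dots> \<le> r"
        proof -
          have "norm (x' - x) \<le> (r - k * norm (y - z)) / (k + 1)"
            using x' by (simp add: dist_norm norm_minus_commute diff_divide_distrib)
          then show ?thesis using k by (simp add: pos_le_divide_eq algebra_simps)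
        qed
        finally have "b \<in> C"
          using r by (auto simp: dist_norm norm_minus_commute)
        then have "(k / (k + 1)) *\<^sub>R y + (1 / (k + 1)) *\<^sub>R b \<in> C"
          using y k by (intro convexD[OF assms(1)]) (auto simp: field_simps)
        moreover have "(k / (k + 1)) *\<^sub>R y + (1 / (k + 1)) *\<^sub>R b = x'"
        proof -
          have "(k / (k + 1)) *\<^sub>R y + (1 / (k + 1)) *\<^sub>R b = (1 / (k + 1) * (k + 1)) *\<^sub>R x'"
            by (simp add: b_def scaleR_right_diff_distrib)
          then show ?thesis using k by simp
        qed
        ultimately show "x' \<in> C" by simp
      qed
      moreover have "(r - k * dist y z) / (k + 1) > 0"
        using y k by (simp add: field_simps)
      ultimately show False
        using assms(3) by (meson mem_interior)
    qed
    obtain p where p: "p \<in> closure C" "\<And>y. y \<in> closure C \<Longrightarrow> dist z p \<le> dist z y"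
      using closest_point_exists_hilbert[of "closure C" z] assms \<open>c \<in> C\<close>
      by (metis closed_closure closure_subset convex_closure empty_iff subsetD)
    \<comment> \<open>The normal at the projection \<open>p\<close> of \<open>z\<close> separates
      \<open>z\<close> from \<open>C\<close>; dividing it by \<open>m\<close> achieves the
      normalisation at \<open>z - c\<close>.\<close>
    define w where "w = z - p"
    have "w \<noteq> 0" using p(1) \<open>z \<notin> closure C\<close> by (auto simp: w_def)
    have sep: "w \<bullet> (v - p) \<le> 0" if "v \<in> C" for v
      unfolding w_def using that closure_subset
      by (intro any_closest_point_dot[of "closure C"] convex_closure assms closed_closure p)
        (auto intro: p)
    define m where "m = w \<bullet> (z - c)"
    have "m = w \<bullet> w - w \<bullet> (c - p)"
      by (simp add: m_def w_def algebra_simps)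
    moreover have "w \<bullet> w > 0" using \<open>w \<noteq> 0\<close> by simp
    ultimately have "m > 0" using sep[OF \<open>c \<in> C\<close>] by linarith
    have "w \<bullet> (v - c) \<le> m" if "v \<in> C" for v
    proof -
      have "m - w \<bullet> (v - c) = w \<bullet> w - w \<bullet> (v - p)"
        by (simp add: m_def w_def algebra_simps)
      then show ?thesis using sep[OF that] \<open>w \<bullet> w > 0\<close> by linarith
    qed
    moreover have "m = (1 + 1 / k) * (w \<bullet> (x - c))"
      by (simp add: m_def z_def algebra_simps)
    then have "(1 / m) * (w \<bullet> (x - c)) = 1 - 1 / (k + 1)"
      using \<open>m > 0\<close> k by (simp add: field_simps)
    ultimately have "(1 / m) *\<^sub>R w \<in> K n"
      using \<open>m > 0\<close> by (simp add: K_def k_def field_simps)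
    then show ?thesis by blast
  qed
  have "bounded (K 0)"
  proof -
    have "norm w \<le> 1 / r" if "w \<in> K 0" for w
    proof (cases "w = 0")
      case False
      have "c + (r / norm w) *\<^sub>R w \<in> C"
        using r False by (auto simp: dist_norm)
      then have "w \<bullet> ((r / norm w) *\<^sub>R w) \<le> 1"
        using that by (auto simp: K_def)
      then have "r * norm w \<le> 1"
        using False by (simp add: power2_norm_eq_inner[symmetric] power2_eq_square)
      then show ?thesis using r by (simp add: field_simps)
    qed (use r in simp)
    then show ?thesis by (auto simp: bounded_iff)
  qed
  moreover have "closed (K n)" for n
  proof -
    have "K n = (\<Inter>v\<in>C. {w. w \<bullet> (v - c) \<le> 1}) \<inter> {w. 1 - 1 / Suc (Suc n) \<le> w \<bullet> (x - c)}"
      by (auto simp: K_def)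
    then show ?thesis
      by (auto intro!: closed_Int closed_INT closed_Collect_le continuous_intros)
  qed
  moreover have "convex (K n)" for n
  proof (rule convexI)
    fix a b :: 'h and s t :: real
    assume *: "a \<in> K n" "b \<in> K n" "0 \<le> s" "0 \<le> t" "s + t = 1"
    have "s * (a \<bullet> (v - c)) + t * (b \<bullet> (v - c)) \<le> 1" if "v \<in> C" for v
      using * that by (intro convex_bound_le) (auto simp: K_def)
    moreover have "s * (- (a \<bullet> (x - c))) + t * (- (b \<bullet> (x - c))) \<le> - (1 - 1 / Suc (Suc n))"
      using * by (intro convex_bound_le) (auto simp: K_def)
    ultimately show "s *\<^sub>R a + t *\<^sub>R b \<in> K n"
      by (simp add: K_def inner_add_left)
  qed
  moreover have "K n \<subseteq> K m" if "m \<le> n" for m n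
  proof -
    have "1 / real (Suc (Suc n)) \<le> 1 / real (Suc (Suc m))"
      using that by (intro divide_left_mono) auto
    then show ?thesis by (auto simp: K_def)
  qed
  ultimately obtain w where w: "\<And>n. w \<in> K n"
    using nested_closed_convex_bounded_meet[of K] nonempty by blast
  have "(\<lambda>n. 1 - 1 / real (Suc (Suc n))) \<longlonglongrightarrow> 1 - 0"
    by (intro tendsto_intros LIMSEQ_Suc[OF LIMSEQ_Suc[OF lim_1_over_n]])
  then have "1 \<le> w \<bullet> (x - c)"
    using w by (intro LIMSEQ_le_const2[of _ 1]) (auto simp: K_def)
  moreover from this have "w \<noteq> 0" by auto
  moreover have "w \<bullet> (v - c) \<le> 1" if "v \<in> C" for v
    using w[of 0] that by (simp add: K_def)
  ultimately show ?thesis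
    using that[of w] by (fastforce simp: inner_diff_right)
qed

section \<open>Sublevel sets of a convex function under a variable bound\<close>

text \<open>Variable bounds are needed because the nested sets used later consist of near-minimisers
  of \<open>f\<close> plus an affine or quadratic term; that term is moved into
  \<open>\<phi>\<close>.\<close>

lemma closed_sublevel_lower_semicontinuous:
  assumes "lower_semicontinuous f" "continuous_on UNIV \<phi>"
  shows "closed {x. f x \<le> ereal (\<phi> x)}"
proof -
  have "\<forall>\<^sub>F y in nhds x. ereal (\<phi> y) < f y" if less: "ereal (\<phi> x) < f x" for x
  proof -
    \<comment> \<open>A real \<open>r\<close> strictly between \<open>\<phi> x\<close> and
      \<open>f x\<close> decouples the two functions: near \<open>x\<close>, semicontinuity keeps
      \<open>f\<close> above \<open>r\<close> and continuity keeps \<open>\<phi>\<close> below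
      it.\<close>
    obtain r where r: "ereal (\<phi> x) < ereal r" "ereal r < f x"
      using ereal_dense2[OF less] by blast
    have "ereal r < Liminf (nhds x) f"
      using assms(1) r(2) unfolding lower_semicontinuous_def by (meson less_le_trans)
    then have "\<forall>\<^sub>F y in nhds x. ereal r < f y"
      by (rule less_LiminfD)
    moreover have "(\<phi> \<longlongrightarrow> \<phi> x) (nhds x)"
      using assms(2) by (simp add: continuous_on_def tendsto_nhds_iff)
    then have "\<forall>\<^sub>F y in nhds x. \<phi> y < r"
      using r(1) by (intro order_tendstoD) auto
    ultimately show ?thesis
      by eventually_elim (meson ereal_less_eq(3) le_less_trans less_imp_le)
  qed
  then have "\<exists>T. open T \<and> x \<in> T \<and> T \<subseteq> {x. ereal (\<phi> x) < f x}"
    if "x \<in> {x. ereal (\<phi> x) < f x}" for x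
    using that by (force simp: eventually_nhds)
  then have "open {x. ereal (\<phi> x) < f x}"
    by (subst open_subopen) blast
  moreover have "- {x. f x \<le> ereal (\<phi> x)} = {x. ereal (\<phi> x) < f x}"
    by auto
  ultimately show ?thesis
    by (simp add: closed_def)
qed

lemma convex_sublevel_econvex:
  assumes "econvex f" "concave_on UNIV \<phi>"
  shows "convex {x. f x \<le> ereal (\<phi> x)}"
  unfolding convex_alt
proof (intro ballI allI impI)
  fix x y and t :: real
  assume x: "x \<in> {x. f x \<le> ereal (\<phi> x)}" and y: "y \<in> {x. f x \<le> ereal (\<phi> x)}"
    and t: "0 \<le> t \<and> t \<le> 1"
  consider "t = 0" | "t = 1" | "0 < t" "t < 1" using t by linarith
  then show "(1 - t) *\<^sub>R x + t *\<^sub>R y \<in> {x. f x \<le> ereal (\<phi> x)}"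
  proof cases
    case 3
    have "f ((1 - t) *\<^sub>R x + t *\<^sub>R y) \<le> ereal (1 - t) * f x + ereal t * f y"
      using assms(1) 3 unfolding econvex_def by blast
    also have "\<dots> \<le> ereal (1 - t) * ereal (\<phi> x) + ereal t * ereal (\<phi> y)"
      using x y t by (intro add_mono ereal_mult_left_mono) auto
    also have "\<dots> \<le> ereal (\<phi> ((1 - t) *\<^sub>R x + t *\<^sub>R y))"
      using concave_onD[OF assms(2), of t x y] t by simp
    finally show ?thesis by simp
  qed (use x y in auto)
qed

lemma concave_on_inner: "concave_on UNIV (\<lambda>x::'h::real_inner. x \<bullet> u + c)"
proof -
  have "(1 - t) * c + t * c = c" for t :: real by (simp add: algebra_simps)
  then show ?thesis
    unfolding concave_on_def convex_on_def
    by (auto simp: inner_add_left algebra_simps distrib_right[symmetric])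
qed

text \<open>Stewart's identity; its last term measures the strong convexity of the squared
  distance.\<close>

lemma power2_norm_convex_combination:
  fixes x y z :: "'h::real_inner"
  shows "(norm ((1 - t) *\<^sub>R x + t *\<^sub>R y - z))\<^sup>2
    = (1 - t) * (norm (x - z))\<^sup>2 + t * (norm (y - z))\<^sup>2 - t * (1 - t) * (norm (x - y))\<^sup>2"
  unfolding power2_norm_eq_inner by (simp add: algebra_simps inner_commute)

lemma concave_on_minus_power2_norm:
  "concave_on UNIV (\<lambda>x::'h::real_inner. c - (norm (x - z))\<^sup>2 / 2)"
  unfolding concave_on_def
proof (rule convex_onI)
  fix t :: real and x y :: 'h
  assume "0 < t" "t < 1"
  then have "t * (1 - t) * (norm (x - y))\<^sup>2 \<ge> 0" by simp
  then show "- (c - (norm ((1 - t) *\<^sub>R x + t *\<^sub>R y - z))\<^sup>2 / 2)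
    \<le> (1 - t) * - (c - (norm (x - z))\<^sup>2 / 2) + t * - (c - (norm (y - z))\<^sup>2 / 2)"
    unfolding power2_norm_convex_combination by argo
qed simp

section \<open>Conjugates, affine minorants and subgradients\<close>

text \<open>The conjugate encodes the affine minorants of slope \<open>v\<close>. This form replaces
  differences in \<open>ereal\<close> by comparisons with real numbers.\<close>

lemma fenchel_conjugate_le_iff:
  assumes "proper f"
  shows "fenchel_conjugate f v \<le> ereal a \<longleftrightarrow> (\<forall>x. ereal (x \<bullet> v - a) \<le> f x)"
proof -
  have "ereal (x \<bullet> v) - f x \<le> ereal a \<longleftrightarrow> ereal (x \<bullet> v - a) \<le> f x" for x
    using assms by (cases "f x") (auto simp: proper_def)
  then show ?thesis by (simp add: fenchel_conjugate_def SUP_le_iff)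
qed

lemma fenchel_young:
  assumes "proper f" "fenchel_conjugate f v = ereal a"
  shows "ereal (x \<bullet> v - a) \<le> f x"
  using fenchel_conjugate_le_iff[OF assms(1), of v a] assms(2) by simp

lemma fenchel_conjugate_ge:
  assumes "f x = ereal r"
  shows "ereal (x \<bullet> v - r) \<le> fenchel_conjugate f v"
  unfolding fenchel_conjugate_def by (rule SUP_upper2[of x]) (simp_all add: assms)

lemma proper_obtains:
  assumes "proper f" obtains x r where "f x = ereal r"
proof -
  obtain x where "f x < \<infinity>" "f x \<noteq> - \<infinity>" using assms by (auto simp: proper_def edom_def)
  then show ?thesis using that by (cases "f x") auto
qed

lemma fenchel_conjugate_not_MInfty:
  assumes "proper f" shows "fenchel_conjugate f v \<noteq> - \<infinity>"
proof -
  obtain x r where "f x = ereal r" using assms by (rule proper_obtains)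
  then show ?thesis using fenchel_conjugate_ge[of f x r v] by auto
qed

lemma fenchel_conjugate_finite:
  assumes "proper f" "v \<in> edom (fenchel_conjugate f)"
  obtains a where "fenchel_conjugate f v = ereal a"
  using fenchel_conjugate_not_MInfty[OF assms(1), of v] assms(2)
  by (cases "fenchel_conjugate f v") (auto simp: edom_def)

text \<open>An average of affine minorants of \<open>f\<close> is again one. The real bounds
  \<open>a\<close> and \<open>b\<close> keep products with infinite values out of the
  statement.\<close>

lemma fenchel_conjugate_convex:
  assumes "proper f" "fenchel_conjugate f v \<le> ereal a" "fenchel_conjugate f w \<le> ereal b"
    and t: "0 \<le> t" "t \<le> 1"
  shows "fenchel_conjugate f ((1 - t) *\<^sub>R v + t *\<^sub>R w) \<le> ereal ((1 - t) * a + t * b)"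
proof -
  have "ereal (x \<bullet> ((1 - t) *\<^sub>R v + t *\<^sub>R w) - ((1 - t) * a + t * b)) \<le> f x" for x
  proof (cases "f x")
    case (real r)
    then have "ereal (x \<bullet> v - a) \<le> ereal r" "ereal (x \<bullet> w - b) \<le> ereal r"
      using assms by (metis fenchel_conjugate_le_iff)+
    then have "(1 - t) * (x \<bullet> v - a) + t * (x \<bullet> w - b) \<le> r"
      using t by (intro convex_bound_le) auto
    then show ?thesis by (simp add: real inner_add_right algebra_simps)
  qed (use assms in \<open>auto simp: proper_def\<close>)
  then show ?thesis using assms(1) by (simp add: fenchel_conjugate_le_iff)
qed

text \<open>A subgradient is the slope of an affine minorant touching \<open>f\<close> at
  \<open>x\<close>, which is equality in the Fenchel-Young inequality. The form with
  \<open>a\<close> also records that both values are finite.\<close>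

lemma subdifferential_iff_fenchel_equality:
  assumes "proper f"
  shows "u \<in> subdifferential f x \<longleftrightarrow>
    (\<exists>a. fenchel_conjugate f u = ereal a \<and> f x = ereal (x \<bullet> u - a))"
proof
  assume u: "u \<in> subdifferential f x"
  obtain y s where y: "f y = ereal s" using assms by (rule proper_obtains)
  have "f x + ereal (u \<bullet> (y - x)) \<le> ereal s"
    using u y unfolding subdifferential_def by (auto dest: spec[of _ y])
  then obtain r where r: "f x = ereal r"
    using assms by (cases "f x") (auto simp: proper_def)
  have "ereal (z \<bullet> u - (x \<bullet> u - r)) \<le> f z" for z
    using u r unfolding subdifferential_def
    by (auto dest!: spec[of _ z] simp: inner_diff_right inner_commute algebra_simps)
  then have "fenchel_conjugate f u \<le> ereal (x \<bullet> u - r)"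
    using assms by (simp add: fenchel_conjugate_le_iff)
  then have "fenchel_conjugate f u = ereal (x \<bullet> u - r)"
    using fenchel_conjugate_ge[of f x r u] r by (intro antisym)
  then show "\<exists>a. fenchel_conjugate f u = ereal a \<and> f x = ereal (x \<bullet> u - a)"
    using r by simp
next
  assume "\<exists>a. fenchel_conjugate f u = ereal a \<and> f x = ereal (x \<bullet> u - a)"
  then obtain a where a: "fenchel_conjugate f u = ereal a" "f x = ereal (x \<bullet> u - a)" by blast
  have "f x + ereal (u \<bullet> (y - x)) \<le> f y" for y
    using fenchel_young[OF assms a(1), of y] a(2)
    by (simp add: inner_diff_right inner_commute algebra_simps)
  then show "u \<in> subdifferential f x" by (simp add: subdifferential_def)
qed

lemma subdifferentialI_fenchel:
  assumes "proper f" "fenchel_conjugate f u = ereal a" "f x \<le> ereal (x \<bullet> u - a)"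
  shows "u \<in> subdifferential f x"
  using assms fenchel_young[OF assms(1,2), of x]
  by (auto simp: subdifferential_iff_fenchel_equality)

text \<open>The easy half of the inversion rule: \<open>x\<close> contributes one affine function to
  the supremum defining the conjugate, and this function touches the conjugate at
  \<open>u\<close>.\<close>

lemma subdifferential_fenchel_conjugateI:
  assumes "proper f" "u \<in> subdifferential f x"
  shows "x \<in> subdifferential (fenchel_conjugate f) u"
proof -
  obtain a where a: "fenchel_conjugate f u = ereal a" "f x = ereal (x \<bullet> u - a)"
    using assms by (auto simp: subdifferential_iff_fenchel_equality)
  have "fenchel_conjugate f u + ereal (x \<bullet> (v - u)) \<le> fenchel_conjugate f v" for v
    using fenchel_conjugate_ge[of f x "x \<bullet> u - a" v] a by (simp add: inner_diff_right algebra_simps)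
  then show ?thesis by (simp add: subdifferential_def)
qed

section \<open>Proximal points and inversion of the subdifferential\<close>

text \<open>Minty's surjectivity theorem: \<open>p\<close> is the proximal point of \<open>z\<close>, the minimiser of
  \<open>f + \<parallel>\<cdot> - z\<parallel>\<^sup>2 / 2\<close>.\<close>

lemma ex_proximal_point:
  fixes f :: "'h::{real_inner, complete_space} \<Rightarrow> ereal"
  assumes f: "f \<in> Gamma0" and ne: "edom (fenchel_conjugate f) \<noteq> {}"
  obtains p where "z - p \<in> subdifferential f p"
proof -
  have pr: "proper f" and lsc: "lower_semicontinuous f" and cvx: "econvex f"
    using f by (auto simp: Gamma0_def)
  obtain v a where a: "fenchel_conjugate f v = ereal a"
    using ne fenchel_conjugate_finite[OF pr] by blast
  \<comment> \<open>Where \<open>f\<close> is infinite, \<open>real_of_ereal\<close> returns 0, so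
    \<open>h\<close> is meaningful only on \<open>edom f\<close>.\<close>
  define h where "h x = real_of_ereal (f x) + (norm (x - z))\<^sup>2 / 2" for x
  define m where "m = (INF x\<in>edom f. h x)"
  \<comment> \<open>The constant left after completing the square: the affine minorant of slope
    \<open>v\<close> plus the quadratic term is half the squared distance from \<open>z - v\<close>
    plus \<open>k\<close>. This bounds \<open>h\<close> from below and makes its sublevel sets
    bounded.\<close>
  define k where "k = z \<bullet> v - (norm v)\<^sup>2 / 2 - a"
  have fin: "f x = ereal (h x - (norm (x - z))\<^sup>2 / 2)" if "x \<in> edom f" for x
    using that pr by (cases "f x") (auto simp: edom_def proper_def h_def)
  have sq: "x \<bullet> v - a + (norm (x - z))\<^sup>2 / 2 = (norm (x - z + v))\<^sup>2 / 2 + k" for x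
    unfolding k_def power2_norm_eq_inner
    by (simp add: algebra_simps add_divide_distrib diff_divide_distrib inner_commute)
  have h_ge: "(norm (x - z + v))\<^sup>2 / 2 + k \<le> h x" if "x \<in> edom f" for x
    using fenchel_young[OF pr a, of x] fin[OF that] sq[of x] by simp
  have "k \<le> h x" if "x \<in> edom f" for x
    using h_ge[OF that] by (smt (verit) zero_le_power2 divide_nonneg_pos)
  then have bdd: "bdd_below (h ` edom f)" by (rule bdd_belowI2)
  have dom_ne: "edom f \<noteq> {}" using pr by (simp add: proper_def)
  have m_le: "m \<le> h x" if "x \<in> edom f" for x
    unfolding m_def using bdd that by (rule cINF_lower)
  \<comment> \<open>The points where \<open>h\<close> is within \<open>1 / Suc n\<close> of its
    infimum, with the quadratic term moved to the right so that the bound on \<open>f\<close> is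
    continuous and concave.\<close>
  define K where "K n = {x. f x \<le> ereal (m + 1 / Suc n - (norm (x - z))\<^sup>2 / 2)}" for n
  have K_iff: "x \<in> K n \<longleftrightarrow> x \<in> edom f \<and> h x \<le> m + 1 / Suc n" for x n
  proof (cases "x \<in> edom f")
    case True
    then show ?thesis using fin[OF True] by (simp add: K_def)
  next
    case False
    then show ?thesis by (auto simp: K_def edom_def)
  qed
  have "K n \<noteq> {}" for n
  proof -
    have "m < m + 1 / Suc n" by simp
    then obtain x where "x \<in> edom f" "h x < m + 1 / Suc n"
      unfolding m_def using cINF_less_iff[OF dom_ne bdd] by blast
    then have "x \<in> K n" by (simp add: K_iff)
    then show ?thesis by blast
  qed
  moreover have "closed (K n)" for n
    unfolding K_def by (intro closed_sublevel_lower_semicontinuous lsc continuous_intros) auto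
  moreover have "convex (K n)" for n
    unfolding K_def by (intro convex_sublevel_econvex cvx concave_on_minus_power2_norm)
  moreover have "K n \<subseteq> K l" if "l \<le> n" for l n
  proof -
    have "1 / real (Suc n) \<le> 1 / real (Suc l)"
      using that by (intro divide_left_mono) auto
    then show ?thesis by (auto simp: K_iff)
  qed
  moreover have "bounded (K 0)"
  proof -
    have "dist (z - v) x \<le> sqrt (2 * (m + 1 - k))" if "x \<in> K 0" for x
    proof -
      have "(norm (x - z + v))\<^sup>2 / 2 + k \<le> m + 1"
        using that h_ge[of x] by (simp add: K_iff)
      then have "norm (x - z + v) \<le> sqrt (2 * (m + 1 - k))"
        by (intro real_le_rsqrt) simp
      then show ?thesis
        by (metis add.commute diff_diff_eq2 dist_commute dist_norm add_diff_eq)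
    qed
    then show ?thesis unfolding bounded_def by blast
  qed
  ultimately obtain p where p: "\<And>n. p \<in> K n"
    using nested_closed_convex_bounded_meet[of K] by blast
  have p_dom: "p \<in> edom f" using p[of 0] by (simp add: K_iff)
  have "(\<lambda>n. m + 1 / Suc n) \<longlonglongrightarrow> m + 0"
    by (intro tendsto_intros LIMSEQ_Suc[OF lim_1_over_n])
  then have "h p \<le> m"
    using p by (intro LIMSEQ_le_const[of _ m]) (auto simp: K_iff)
  have "f p + ereal ((z - p) \<bullet> (y - p)) \<le> f y" for y
  proof (cases "y \<in> edom f")
    case True
    obtain r where r: "f p = ereal r" using fin[OF p_dom] by blast
    obtain s where s: "f y = ereal s" using fin[OF True] by blast
    \<comment> \<open>First-order optimality: \<open>p\<close> is compared with a point on the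
      segment towards \<open>y\<close>, the inequality is divided by \<open>t\<close>, and the
      quadratic remainder vanishes as \<open>t\<close> tends to 0.\<close>
    have le: "r + (z - p) \<bullet> (y - p) \<le> s + t * ((norm (y - p))\<^sup>2 / 2)" if t: "0 < t" "t < 1" for t
    proof -
      define x where "x = (1 - t) *\<^sub>R p + t *\<^sub>R y"
      have fx: "f x \<le> ereal ((1 - t) * r + t * s)"
        using cvx t r s unfolding econvex_def x_def by (metis plus_ereal.simps(1) times_ereal.simps(1))
      then have x_dom: "x \<in> edom f" by (auto simp: edom_def)
      have "h p \<le> h x" using \<open>h p \<le> m\<close> m_le[OF x_dom] by linarith
      then have "r + (norm (p - z))\<^sup>2 / 2 \<le> (1 - t) * r + t * s + (norm (x - z))\<^sup>2 / 2"
      proof -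
        have "h x - (norm (x - z))\<^sup>2 / 2 \<le> (1 - t) * r + t * s"
          using fx unfolding fin[OF x_dom] by simp
        moreover have "h p = r + (norm (p - z))\<^sup>2 / 2" by (simp add: h_def r)
        ultimately show ?thesis using \<open>h p \<le> h x\<close> by linarith
      qed
      moreover have "(norm (x - z))\<^sup>2 = (norm (p - z))\<^sup>2 - 2 * t * ((z - p) \<bullet> (y - p))
          + t * (t * (norm (y - p))\<^sup>2)"
        unfolding x_def power2_norm_eq_inner by (simp add: algebra_simps inner_commute)
      ultimately have "t * (r + (z - p) \<bullet> (y - p)) \<le> t * (s + t * ((norm (y - p))\<^sup>2 / 2))"
        by (simp add: distrib_left left_diff_distrib add_divide_distrib diff_divide_distrib)
      then show ?thesis using t by simp
    qed
    have "((\<lambda>t. s + t * ((norm (y - p))\<^sup>2 / 2)) \<longlongrightarrow> s + 0 * ((norm (y - p))\<^sup>2 / 2)) (at_right 0)"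
      by (intro tendsto_intros)
    moreover have "\<forall>\<^sub>F t in at_right 0. r + (z - p) \<bullet> (y - p) \<le> s + t * ((norm (y - p))\<^sup>2 / 2)"
      using le by (auto simp: eventually_at_right_field intro: exI[of _ 1])
    ultimately have "r + (z - p) \<bullet> (y - p) \<le> s"
      by (auto dest!: tendsto_lowerbound)
    then show ?thesis by (simp add: r s)
  qed (auto simp: edom_def)
  then have "z - p \<in> subdifferential f p" by (simp add: subdifferential_def)
  then show ?thesis by (rule that)
qed

text \<open>By Minty, \<open>x + u = p + q\<close> with \<open>q \<in> \<partial>f(p)\<close>; since \<open>p \<in> \<partial>f\<^sup>*(q)\<close>, monotonicity of
  \<open>\<partial>f\<^sup>*\<close> gives \<open>0 \<le> (x - p) \<bullet> (u - q) = - \<parallel>x - p\<parallel>\<^sup>2\<close>. This replaces the biconjugate theorem.\<close>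

lemma subdifferential_fenchel_conjugateD:
  fixes f :: "'h::{real_inner, complete_space} \<Rightarrow> ereal"
  assumes f: "f \<in> Gamma0" and ne: "edom (fenchel_conjugate f) \<noteq> {}"
    and x: "x \<in> subdifferential (fenchel_conjugate f) u"
  shows "u \<in> subdifferential f x"
proof -
  have pr: "proper f" using f by (simp add: Gamma0_def)
  obtain p where p: "x + u - p \<in> subdifferential f p"
    using ex_proximal_point[OF f ne, of "x + u"] by blast
  define q where "q = x + u - p"
  obtain b where b: "fenchel_conjugate f q = ereal b"
    using p pr by (auto simp: q_def subdifferential_iff_fenchel_equality)
  have 1: "fenchel_conjugate f q + ereal (p \<bullet> (u - q)) \<le> fenchel_conjugate f u"
    using subdifferential_fenchel_conjugateI[OF pr p] unfolding q_def subdifferential_def by blast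
  have 2: "fenchel_conjugate f u + ereal (x \<bullet> (q - u)) \<le> fenchel_conjugate f q"
    using x by (simp add: subdifferential_def)
  obtain a where a: "fenchel_conjugate f u = ereal a"
    using 2 b fenchel_conjugate_not_MInfty[OF pr, of u] by (cases "fenchel_conjugate f u") auto
  have "p \<bullet> (u - q) + x \<bullet> (q - u) \<le> 0"
    using 1 2 by (simp add: a b)
  moreover have "p \<bullet> (u - q) + x \<bullet> (q - u) = (p - x) \<bullet> (p - x)"
    unfolding q_def by (simp add: algebra_simps inner_commute)
  ultimately have "(p - x) \<bullet> (p - x) = 0"
    by (metis inner_ge_zero order_antisym)
  then show ?thesis using p by simp
qed

section \<open>Directional derivatives of the conjugate inside its domain\<close>

lemma interior_ray:
  fixes u :: "'h::real_normed_vector"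
  assumes "u \<in> interior C"
  obtains s where "s > 0" "\<And>t. 0 \<le> t \<Longrightarrow> t \<le> s \<Longrightarrow> u + t *\<^sub>R y \<in> C"
proof -
  obtain r where r: "r > 0" "ball u r \<subseteq> C" using assms by (auto simp: mem_interior)
  \<comment> \<open>The summand 1 covers \<open>y = 0\<close> and makes the estimate below
    strict.\<close>
  define s where "s = r / (norm y + 1)"
  have "s > 0" using r by (simp add: s_def add_nonneg_pos)
  moreover have "u + t *\<^sub>R y \<in> C" if t: "0 \<le> t" "t \<le> s" for t
  proof -
    have "t * norm y \<le> s * norm y" using t by (intro mult_right_mono) auto
    also have "\<dots> < s * (norm y + 1)" using \<open>s > 0\<close> by simp
    also have "\<dots> = r" by (simp add: s_def add_nonneg_eq_0_iff)
    finally have "u + t *\<^sub>R y \<in> ball u r" using t by (simp add: dist_norm)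
    then show ?thesis using r by blast
  qed
  ultimately show ?thesis using that by blast
qed

text \<open>Interiority leaves room in every direction \<open>v\<close>, and Fenchel-Young at
  \<open>u + s *\<^sub>R v\<close> bounds \<open>x \<bullet> v\<close> on the set; uniform
  boundedness does the rest.\<close>

lemma bounded_sublevel_interior_edom_fenchel_conjugate:
  fixes f :: "'h::{real_inner, complete_space} \<Rightarrow> ereal"
  assumes pr: "proper f" and u: "u \<in> interior (edom (fenchel_conjugate f))"
  shows "bounded {x. f x \<le> ereal (x \<bullet> u + c)}"
proof (rule bounded_if_inner_bounded_above)
  fix v
  obtain s where "s > 0"
      "\<And>t. 0 \<le> t \<Longrightarrow> t \<le> s \<Longrightarrow> u + t *\<^sub>R v \<in> edom (fenchel_conjugate f)"
    using interior_ray[OF u] by blast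
  then have s: "s > 0" "u + s *\<^sub>R v \<in> edom (fenchel_conjugate f)" by simp_all
  obtain a where a: "fenchel_conjugate f (u + s *\<^sub>R v) = ereal a"
    using fenchel_conjugate_finite[OF pr s(2)] by blast
  have "x \<bullet> v \<le> (c + a) / s" if "f x \<le> ereal (x \<bullet> u + c)" for x
  proof -
    have "ereal (x \<bullet> (u + s *\<^sub>R v) - a) \<le> ereal (x \<bullet> u + c)"
      using fenchel_young[OF pr a, of x] that by (rule order_trans)
    then show ?thesis using s by (simp add: inner_add_right field_simps)
  qed
  then show "\<exists>M. \<forall>x\<in>{x. f x \<le> ereal (x \<bullet> u + c)}. x \<bullet> v \<le> M"
    by blast
qed

text \<open>The max formula: the directional derivative of \<open>f\<^sup>*\<close> at an interior point is attained by a
  subgradient. The subgradient is a common point of the sets of approximate maximisers of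
  \<open>x \<mapsto> x \<bullet> u - f x\<close> whose slope in direction \<open>y\<close> is almost \<open>p\<close>; such points arise as approximate
  maximisers for \<open>u + t y\<close> with \<open>t\<close> small.\<close>

lemma ex_subgradient_slope_ge:
  fixes f :: "'h::{real_inner, complete_space} \<Rightarrow> ereal"
  assumes f: "f \<in> Gamma0" and u: "u \<in> interior (edom (fenchel_conjugate f))"
    and F: "fenchel_conjugate f u = ereal F" and "s > 0"
    and slope: "\<And>t. 0 < t \<Longrightarrow> t \<le> s \<Longrightarrow> ereal (F + t * p) \<le> fenchel_conjugate f (u + t *\<^sub>R y)"
  obtains x where "u \<in> subdifferential f x" "p \<le> x \<bullet> y"
proof -
  have pr: "proper f" and lsc: "lower_semicontinuous f" and cvx: "econvex f"
    using f by (auto simp: Gamma0_def)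
  obtain s0 where s0: "s0 > 0"
      "\<And>t. 0 \<le> t \<Longrightarrow> t \<le> s0 \<Longrightarrow> u + t *\<^sub>R y \<in> edom (fenchel_conjugate f)"
    using interior_ray[OF u] by blast
  define d where "d = min s s0"
  have d: "d > 0" "d \<le> s" "d \<le> s0" using s0 \<open>s > 0\<close> by (auto simp: d_def)
  obtain G where G: "fenchel_conjugate f (u + d *\<^sub>R y) = ereal G"
    using fenchel_conjugate_finite[OF pr s0(2)[of d]] d by auto
  \<comment> \<open>\<open>N\<close> will bound \<open>(d - t) * (x \<bullet> y)\<close> for the
    approximate maximisers; since \<open>t \<le> d / 2\<close>, this gives
    \<open>x \<bullet> y \<le> B\<close> independently of \<open>t\<close>.\<close>
  define N where "N = \<bar>G - F\<bar> + d * \<bar>p\<bar> + 1"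
  define B where "B = 2 * N / d"
  have "N \<ge> 0" using d by (simp add: N_def)
  then have B: "B \<ge> 0" using d by (simp add: B_def)
  define K where "K n = {x. f x \<le> ereal (x \<bullet> u + (1 / Suc n - F))} \<inter> {x. p - 1 / Suc n \<le> x \<bullet> y}"
    for n
  have "K n \<noteq> {}" for n
  proof -
    define e where "e = 1 / real (Suc n)"
    have e: "e > 0" "e \<le> 1" by (auto simp: e_def)
    \<comment> \<open>The first bound keeps \<open>d - t\<close> away from 0. The second makes the
      loss from replacing \<open>u + t *\<^sub>R y\<close> by \<open>u\<close> at most
      \<open>e\<close>.\<close>
    define t where "t = min (d / 2) (e / (B + \<bar>p\<bar> + 1))"
    have "0 < t"
      using d e B by (auto simp: t_def intro!: divide_pos_pos add_nonneg_pos)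
    then have t: "0 < t" "t \<le> d / 2" "t \<le> e / (B + \<bar>p\<bar> + 1)"
      by (simp_all only: t_def min.cobounded1 min.cobounded2)
    have te: "t * (B + \<bar>p\<bar> + 1) \<le> e"
      using t(3) B by (simp add: pos_le_divide_eq add_nonneg_pos)
    have "t * 1 \<le> t * (B + \<bar>p\<bar> + 1)"
      using t B by (intro mult_left_mono) auto
    then have "t \<le> e" using te by simp
    obtain H where H: "fenchel_conjugate f (u + t *\<^sub>R y) = ereal H"
      using fenchel_conjugate_finite[OF pr s0(2)[of t]] t d by auto
    have H_ge: "F + t * p \<le> H" using slope[of t] t d H by simp
    \<comment> \<open>The error \<open>t\<^sup>2\<close> is of higher order: after division by
      \<open>t\<close> it changes the slope by only \<open>t\<close>.\<close>
    have "ereal (H - t\<^sup>2) < fenchel_conjugate f (u + t *\<^sub>R y)" using t H by simp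
    then obtain x where x: "ereal (H - t\<^sup>2) < ereal (x \<bullet> (u + t *\<^sub>R y)) - f x"
      unfolding fenchel_conjugate_def less_SUP_iff by blast
    obtain r where r: "f x = ereal r"
      using x pr by (cases "f x") (auto simp: proper_def)
    \<comment> \<open>The first inequality is near-maximality at \<open>u + t *\<^sub>R y\<close>,
      the other two are Fenchel-Young at \<open>u\<close> and at \<open>u + d *\<^sub>R y\<close>.
      The first two bound the slope \<open>x \<bullet> y\<close> from below, the first and third
      from above.\<close>
    have 1: "r < x \<bullet> u + t * (x \<bullet> y) - H + t\<^sup>2" using x r by (simp add: inner_add_right)
    have 2: "x \<bullet> u - F \<le> r" using fenchel_young[OF pr F, of x] r by simp
    have 3: "x \<bullet> u + d * (x \<bullet> y) - G \<le> r"
      using fenchel_young[OF pr G, of x] r by (simp add: inner_add_right)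
    have "t * (p - t) \<le> t * (x \<bullet> y)"
      using 1 2 H_ge by (simp add: algebra_simps power2_eq_square)
    then have low: "p - e \<le> x \<bullet> y" using t \<open>t \<le> e\<close> by simp
    have "t\<^sup>2 \<le> 1" using t \<open>t \<le> e\<close> e by (simp add: power_le_one)
    moreover have "- (t * p) \<le> d * \<bar>p\<bar>"
    proof -
      have "- (t * p) \<le> t * \<bar>p\<bar>" using t mult_left_mono[of "- p" "\<bar>p\<bar>" t] by simp
      also have "\<dots> \<le> d * \<bar>p\<bar>" using t d by (intro mult_right_mono) auto
      finally show ?thesis .
    qed
    ultimately have up: "(d - t) * (x \<bullet> y) \<le> N"
      using 1 3 H_ge unfolding N_def by (simp add: algebra_simps)
    have "x \<bullet> y \<le> B"
    proof (cases "x \<bullet> y \<ge> 0")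
      case True
      have "(d / 2) * (x \<bullet> y) \<le> (d - t) * (x \<bullet> y)"
        using True t by (intro mult_right_mono) auto
      then show ?thesis using up d by (simp add: B_def field_simps)
    qed (use B in auto)
    then have "t * (x \<bullet> y - p + t) \<le> t * (B + \<bar>p\<bar> + 1)"
      using t \<open>t \<le> e\<close> e by (intro mult_left_mono) auto
    then have "r \<le> x \<bullet> u + (e - F)"
      using 1 te H_ge by (simp add: algebra_simps power2_eq_square)
    then have "x \<in> K n" using low by (simp add: K_def r e_def)
    then show ?thesis by blast
  qed
  moreover have "closed (K n)" for n
    unfolding K_def
    by (intro closed_Int closed_sublevel_lower_semicontinuous lsc closed_Collect_le continuous_intros)
  moreover have "convex (K n)" for n
  proof -
    have "convex {x. p - 1 / Suc n \<le> x \<bullet> y}"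
      using convex_halfspace_ge[of "p - 1 / Suc n" y] by (simp add: inner_commute)
    then show ?thesis
      unfolding K_def by (intro convex_Int convex_sublevel_econvex cvx concave_on_inner)
  qed
  moreover have "K n \<subseteq> K m" if "m \<le> n" for m n
  proof -
    have "1 / real (Suc n) \<le> 1 / real (Suc m)"
      using that by (intro divide_left_mono) auto
    then show ?thesis unfolding K_def by (auto elim: order_trans)
  qed
  moreover have "bounded (K 0)"
    unfolding K_def
    by (intro bounded_Int disjI1 bounded_sublevel_interior_edom_fenchel_conjugate pr u)
  ultimately obtain x where x: "\<And>n. x \<in> K n"
    using nested_closed_convex_bounded_meet[of K] by blast
  have "(\<lambda>n. p - 1 / Suc n) \<longlonglongrightarrow> p - 0"
    by (intro tendsto_intros LIMSEQ_Suc[OF lim_1_over_n])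
  then have "p \<le> x \<bullet> y"
    using x by (intro LIMSEQ_le_const2[of _ p]) (auto simp: K_def)
  moreover have "u \<in> subdifferential f x"
  proof -
    have "f x \<le> ereal (x \<bullet> u + (1 - F))" using x[of 0] by (simp add: K_def)
    then obtain r where r: "f x = ereal r"
      using pr by (cases "f x") (auto simp: proper_def)
    have "(\<lambda>n. x \<bullet> u + (1 / Suc n - F)) \<longlonglongrightarrow> x \<bullet> u + (0 - F)"
      by (intro tendsto_intros LIMSEQ_Suc[OF lim_1_over_n])
    then have "r \<le> x \<bullet> u + (0 - F)"
      using x by (intro LIMSEQ_le_const) (auto simp: K_def r)
    then show ?thesis using r by (intro subdifferentialI_fenchel[OF pr F]) simp
  qed
  ultimately show ?thesis using that by blast
qed

text \<open>In the direction 0 with slope 0 the max formula has a trivial slope hypothesis, and what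
  remains is the existence of a subgradient.\<close>

lemma ex_subgradient_interior_edom_fenchel_conjugate:
  fixes f :: "'h::{real_inner, complete_space} \<Rightarrow> ereal"
  assumes f: "f \<in> Gamma0" and u: "u \<in> interior (edom (fenchel_conjugate f))"
  obtains x where "u \<in> subdifferential f x"
proof -
  have pr: "proper f" using f by (simp add: Gamma0_def)
  obtain F where F: "fenchel_conjugate f u = ereal F"
    using u interior_subset fenchel_conjugate_finite[OF pr] by blast
  show ?thesis
    using ex_subgradient_slope_ge[OF f u F, of 1 0 0] F that by auto
qed

text \<open>The subgradient \<open>x\<close> bounds the difference quotients from below by
  \<open>y \<bullet> x\<close>; the max formula and uniqueness of \<open>x\<close> force them down
  to this value.\<close>

lemma has_gateaux_derivative_fenchel_conjugate:
  fixes f :: "'h::{real_inner, complete_space} \<Rightarrow> ereal"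
  assumes f: "f \<in> Gamma0" and u: "u \<in> interior (edom (fenchel_conjugate f))"
    and x: "u \<in> subdifferential f x"
    and unique: "\<And>x'. u \<in> subdifferential f x' \<Longrightarrow> x' = x"
  shows "has_gateaux_derivative (fenchel_conjugate f) (\<lambda>y. y \<bullet> x) u"
proof -
  have pr: "proper f" using f by (simp add: Gamma0_def)
  obtain F where F: "fenchel_conjugate f u = ereal F" "f x = ereal (x \<bullet> u - F)"
    using x pr by (auto simp: subdifferential_iff_fenchel_equality)
  have "((\<lambda>\<alpha>. (fenchel_conjugate f (u + \<alpha> *\<^sub>R y) - fenchel_conjugate f u) / ereal \<alpha>)
      \<longlongrightarrow> ereal (y \<bullet> x)) (at_right 0)" for y
  proof -
    obtain s where s: "s > 0"
        "\<And>t. 0 \<le> t \<Longrightarrow> t \<le> s \<Longrightarrow> u + t *\<^sub>R y \<in> edom (fenchel_conjugate f)"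
      using interior_ray[OF u] by blast
    define G where "G t = real_of_ereal (fenchel_conjugate f (u + t *\<^sub>R y))" for t
    have G: "fenchel_conjugate f (u + t *\<^sub>R y) = ereal (G t)" if "0 \<le> t" "t \<le> s" for t
      using fenchel_conjugate_finite[OF pr s(2)[OF that]] by (metis G_def real_of_ereal.simps(1))
    have low: "y \<bullet> x \<le> (G t - F) / t" if "0 < t" "t \<le> s" for t
    proof -
      have "ereal (x \<bullet> (u + t *\<^sub>R y) - (x \<bullet> u - F)) \<le> ereal (G t)"
        using fenchel_conjugate_ge[of f x "x \<bullet> u - F" "u + t *\<^sub>R y"] F G[of t] that by simp
      then show ?thesis using that by (simp add: inner_add_right inner_commute field_simps)
    qed
    have "((\<lambda>t. (G t - F) / t) \<longlongrightarrow> y \<bullet> x) (at_right 0)"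
    proof (rule order_tendstoI)
      fix a assume "a < y \<bullet> x"
      then show "\<forall>\<^sub>F t in at_right 0. a < (G t - F) / t"
        unfolding eventually_at_right_field using low s(1)
        by (intro exI[of _ s]) (auto intro: less_le_trans)
    next
      fix a assume a: "y \<bullet> x < a"
      \<comment> \<open>If the quotients stayed at or above \<open>a\<close>, the max formula would
        yield a subgradient of slope at least \<open>a\<close> in direction \<open>y\<close>,
        different from \<open>x\<close>.\<close>
      have "\<exists>t0. 0 < t0 \<and> t0 \<le> s \<and> G t0 < F + t0 * a"
      proof (rule ccontr)
        assume "\<not> ?thesis"
        then have "ereal (F + t * a) \<le> fenchel_conjugate f (u + t *\<^sub>R y)" if "0 < t" "t \<le> s" for t
          using that G[of t] by force
        then obtain x' where "u \<in> subdifferential f x'" "a \<le> x' \<bullet> y"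
          using ex_subgradient_slope_ge[OF f u F(1) s(1)] by blast
        then show False using unique a by (auto simp: inner_commute)
      qed
      then obtain t0 where t0: "0 < t0" "t0 \<le> s" "G t0 < F + t0 * a" by blast
      have "(G t - F) / t < a" if t: "0 < t" "t < t0" for t
      proof -
        \<comment> \<open>Convexity makes the quotients monotone in \<open>t\<close>, so the bound
          at \<open>t0\<close> passes to all smaller \<open>t\<close>.\<close>
        have "fenchel_conjugate f ((1 - t / t0) *\<^sub>R u + (t / t0) *\<^sub>R (u + t0 *\<^sub>R y))
            \<le> ereal ((1 - t / t0) * F + t / t0 * G t0)"
          using t t0 F G[of t0] by (intro fenchel_conjugate_convex[OF pr]) auto
        moreover have "(1 - t / t0) *\<^sub>R u + (t / t0) *\<^sub>R (u + t0 *\<^sub>R y) = u + t *\<^sub>R y"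
          using t0 by (simp add: algebra_simps)
        ultimately have "G t \<le> (1 - t / t0) * F + t / t0 * G t0"
          using G[of t] t t0 by simp
        also have "\<dots> < (1 - t / t0) * F + t / t0 * (F + t0 * a)"
          using t t0 by (intro add_strict_left_mono mult_strict_left_mono) auto
        also have "\<dots> = F + t * a" using t0 by (simp add: field_simps)
        finally show ?thesis using t by (simp add: field_simps)
      qed
      then show "\<forall>\<^sub>F t in at_right 0. (G t - F) / t < a"
        unfolding eventually_at_right_field using t0(1) by blast
    qed
    then have "((\<lambda>t. ereal ((G t - F) / t)) \<longlongrightarrow> ereal (y \<bullet> x)) (at_right 0)"
      by simp
    moreover have "\<forall>\<^sub>F t in at_right 0. ereal ((G t - F) / t)
        = (fenchel_conjugate f (u + t *\<^sub>R y) - fenchel_conjugate f u) / ereal t"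
      unfolding eventually_at_right_field using s(1) G F
      by (intro exI[of _ s]) auto
    ultimately show ?thesis by (rule Lim_transform_eventually)
  qed
  then show ?thesis
    unfolding has_gateaux_derivative_def using F by (auto intro: bounded_linear_inner_left)
qed

text \<open>Difference quotients give \<open>y \<bullet> x \<le> D y\<close>; the same at
  \<open>- y\<close> and linearity of \<open>D\<close> give the reverse. Hence two subgradients at
  \<open>u\<close> coincide.\<close>

lemma has_gateaux_derivative_subgradient_unique:
  assumes D: "has_gateaux_derivative g D u" and x: "x \<in> subdifferential g u"
  shows "D y = y \<bullet> x"
proof -
  have lin: "bounded_linear D" using D by (simp add: has_gateaux_derivative_def)
  obtain F where F: "g u = ereal F"
    using D by (auto simp: has_gateaux_derivative_def)
  have ge: "y \<bullet> x \<le> D y" for y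
  proof -
    have "ereal (y \<bullet> x) \<le> (g (u + t *\<^sub>R y) - g u) / ereal t" if "t > 0" for t
    proof -
      have "ereal F + ereal (x \<bullet> (t *\<^sub>R y)) \<le> g (u + t *\<^sub>R y)"
        using x F unfolding subdifferential_def by (auto dest: spec[of _ "u + t *\<^sub>R y"])
      then show ?thesis using that F
        by (cases "g (u + t *\<^sub>R y)") (auto simp: field_simps inner_commute)
    qed
    then have "\<forall>\<^sub>F t in at_right 0. ereal (y \<bullet> x) \<le> (g (u + t *\<^sub>R y) - g u) / ereal t"
      by (auto simp: eventually_at_right_field intro: exI[of _ 1])
    moreover have "((\<lambda>t. (g (u + t *\<^sub>R y) - g u) / ereal t) \<longlongrightarrow> ereal (D y)) (at_right 0)"
      using D by (simp add: has_gateaux_derivative_def)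
    ultimately show ?thesis by (auto dest!: tendsto_lowerbound)
  qed
  have "D (- y) = - D y" using lin by (simp add: bounded_linear.linear linear_neg)
  then show ?thesis using ge[of y] ge[of "- y"] by simp
qed

text \<open>The subgradient supplies the uniqueness behind the definite description in
  \<open>gateaux_gradient\<close>.\<close>

lemma gateaux_gradient_eqI:
  assumes "has_gateaux_derivative g (\<lambda>y. y \<bullet> x) u" "x \<in> subdifferential g u"
  shows "gateaux_gradient g u = x"
  unfolding gateaux_gradient_def
proof (rule the_equality)
  fix v assume "has_gateaux_derivative g (\<lambda>y. y \<bullet> v) u"
  then have "y \<bullet> v = y \<bullet> x" for y
    using has_gateaux_derivative_subgradient_unique assms(2) by metis
  then show "v = x" using vector_eq_ldot by blast
qed (rule assms)

section \<open>Almost strict convexity and injectivity of the subdifferential\<close>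

text \<open>Between \<open>x\<close> and \<open>y\<close>, convexity presses \<open>f\<close> down
  to the affine minorant of slope \<open>u\<close> that it meets at both ends. So \<open>u\<close>
  is a subgradient along the whole segment, and affinity contradicts strict convexity at the
  midpoint.\<close>

lemma subgradient_unique_if_almost_strictly_convex:
  fixes f :: "'h::real_inner \<Rightarrow> ereal"
  assumes pr: "proper f" and asc: "almost_strictly_convex f"
    and cvx: "econvex f"
    and x: "u \<in> subdifferential f x" and y: "u \<in> subdifferential f y"
  shows "x = y"
proof (rule ccontr)
  assume "x \<noteq> y"
  obtain a where a: "fenchel_conjugate f u = ereal a" "f x = ereal (x \<bullet> u - a)"
    using x pr by (auto simp: subdifferential_iff_fenchel_equality)
  have fy: "f y = ereal (y \<bullet> u - a)"
    using y pr a(1) by (auto simp: subdifferential_iff_fenchel_equality)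
  have "convex {z. f z \<le> ereal (z \<bullet> u + (- a))}"
    by (intro convex_sublevel_econvex cvx concave_on_inner)
  then have seg: "closed_segment x y \<subseteq> {z. f z \<le> ereal (z \<bullet> u + (- a))}"
    using a fy by (intro closed_segment_subset) auto
  have "closed_segment x y \<subseteq> dom_subdifferential f"
  proof
    fix z assume "z \<in> closed_segment x y"
    then have "u \<in> subdifferential f z"
      using seg by (intro subdifferentialI_fenchel[OF pr a(1)]) auto
    then show "z \<in> dom_subdifferential f" by (auto simp: dom_subdifferential_def)
  qed
  then have "strictly_convex_on (closed_segment x y) f"
    using asc by (simp add: almost_strictly_convex_def)
  moreover have "0 < (1/2::real)" "(1/2::real) < 1" by simp_all
  ultimately have "f ((1 - 1/2) *\<^sub>R x + (1/2) *\<^sub>R y) < ereal (1 - 1/2) * f x + ereal (1/2) * f y"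
    unfolding strictly_convex_on_def using \<open>x \<noteq> y\<close> ends_in_segment by blast
  also have "\<dots> = ereal (((1 - 1/2) *\<^sub>R x + (1/2) *\<^sub>R y) \<bullet> u - a)"
    by (simp add: a fy inner_add_left field_simps)
  also have "\<dots> \<le> f ((1 - 1/2) *\<^sub>R x + (1/2) *\<^sub>R y)"
    by (rule fenchel_young[OF pr a(1)])
  finally show False by simp
qed

text \<open>A point of the segment where strict convexity fails has a subgradient \<open>u\<close>, and \<open>f\<close> coincides
  with the affine minorant of slope \<open>u\<close> at both ends.\<close>

lemma almost_strictly_convex_if_subgradient_unique:
  fixes f :: "'h::real_inner \<Rightarrow> ereal"
  assumes pr: "proper f"
    and unique: "\<And>u x y. u \<in> subdifferential f x \<Longrightarrow> u \<in> subdifferential f y \<Longrightarrow> x = y"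
  shows "almost_strictly_convex f"
  unfolding almost_strictly_convex_def strictly_convex_on_def
proof (intro allI impI ballI)
  fix a b x y and t :: real
  assume sub: "closed_segment a b \<subseteq> dom_subdifferential f"
    and xy: "x \<in> closed_segment a b" "y \<in> closed_segment a b"
    and t: "x \<noteq> y \<and> 0 < t \<and> t < 1"
  define z where "z = (1 - t) *\<^sub>R x + t *\<^sub>R y"
  have fin: "\<exists>r. f w = ereal r" if "w \<in> closed_segment a b" for w
    using sub that pr by (auto simp: dom_subdifferential_def subdifferential_iff_fenchel_equality)
  obtain r where r: "f x = ereal r" using fin xy by blast
  obtain s where s: "f y = ereal s" using fin xy by blast
  have "z \<in> closed_segment a b"
    using convexD_alt[OF convex_closed_segment xy, of t] t by (simp add: z_def)
  then obtain u where "u \<in> subdifferential f z"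
    using sub by (auto simp: dom_subdifferential_def)
  then obtain c where c: "fenchel_conjugate f u = ereal c" "f z = ereal (z \<bullet> u - c)"
    using pr by (auto simp: subdifferential_iff_fenchel_equality)
  have r_ge: "x \<bullet> u - c \<le> r" and s_ge: "y \<bullet> u - c \<le> s"
    using fenchel_young[OF pr c(1)] r s by (metis ereal_less_eq(3))+
  have z_eq: "z \<bullet> u - c = (1 - t) * (x \<bullet> u - c) + t * (y \<bullet> u - c)"
    by (simp add: z_def inner_add_left algebra_simps)
  have "z \<bullet> u - c < (1 - t) * r + t * s"
  proof (rule ccontr)
    assume "\<not> ?thesis"
    then have "(1 - t) * (r - (x \<bullet> u - c)) + t * (s - (y \<bullet> u - c)) \<le> 0"
      using z_eq by (simp add: algebra_simps)
    moreover have "(1 - t) * (r - (x \<bullet> u - c)) \<ge> 0" "t * (s - (y \<bullet> u - c)) \<ge> 0"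
      using t r_ge s_ge by auto
    ultimately have "(1 - t) * (r - (x \<bullet> u - c)) = 0" "t * (s - (y \<bullet> u - c)) = 0"
      by linarith+
    then have "r = x \<bullet> u - c" "s = y \<bullet> u - c" using t by auto
    then have "u \<in> subdifferential f x" "u \<in> subdifferential f y"
      using r s by (auto intro!: subdifferentialI_fenchel[OF pr c(1)])
    then show False using unique t by blast
  qed
  then show "f ((1 - t) *\<^sub>R x + t *\<^sub>R y) < ereal (1 - t) * f x + ereal t * f y"
    using c(2) r s by (simp add: z_def)
qed

text \<open>At a boundary point of its domain the subdifferential of \<open>f\<^sup>*\<close> is invariant under adding
  a normal vector, hence never a singleton.\<close>

lemma interior_if_subgradient_unique:
  fixes f :: "'h::{real_inner, complete_space} \<Rightarrow> ereal"
  assumes f: "f \<in> Gamma0" and int: "interior (edom (fenchel_conjugate f)) \<noteq> {}"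
    and x: "u \<in> subdifferential f x"
    and unique: "\<And>y. u \<in> subdifferential f y \<Longrightarrow> x = y"
  shows "u \<in> interior (edom (fenchel_conjugate f))"
proof (rule ccontr)
  assume "u \<notin> interior (edom (fenchel_conjugate f))"
  have pr: "proper f" using f by (simp add: Gamma0_def)
  have ne: "edom (fenchel_conjugate f) \<noteq> {}" using int interior_subset by fastforce
  obtain w where w: "w \<noteq> 0" "\<And>v. v \<in> edom (fenchel_conjugate f) \<Longrightarrow> w \<bullet> v \<le> w \<bullet> u"
    using supporting_functional_convex[OF convex_edom_fenchel_conjugate[OF pr] int
        \<open>u \<notin> interior (edom (fenchel_conjugate f))\<close>] by blast
  obtain a where a: "fenchel_conjugate f u = ereal a"
    using x pr by (auto simp: subdifferential_iff_fenchel_equality)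
  have "fenchel_conjugate f u + ereal ((x + w) \<bullet> (v - u)) \<le> fenchel_conjugate f v" for v
  proof (cases "v \<in> edom (fenchel_conjugate f)")
    case True
    then have "(x + w) \<bullet> (v - u) \<le> x \<bullet> (v - u)"
      using w(2) by (simp add: inner_add_left inner_diff_right)
    then have "fenchel_conjugate f u + ereal ((x + w) \<bullet> (v - u))
        \<le> fenchel_conjugate f u + ereal (x \<bullet> (v - u))"
      using a by simp
    also have "\<dots> \<le> fenchel_conjugate f v"
      using subdifferential_fenchel_conjugateI[OF pr x] by (simp add: subdifferential_def)
    finally show ?thesis .
  qed (auto simp: edom_def)
  then have "x + w \<in> subdifferential (fenchel_conjugate f) u"
    by (simp add: subdifferential_def)
  \<comment> \<open>The inversion rule turns the shifted subgradient of the conjugate into a second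
    point at which \<open>u\<close> is a subgradient of \<open>f\<close>.\<close>
  then have "u \<in> subdifferential f (x + w)"
    by (rule subdifferential_fenchel_conjugateD[OF f ne])
  then show False using unique w(1) by fastforce
qed

section \<open>The equivalence and the formulas for domain and range\<close>

theorem corollary7p11:
  fixes f :: "'h::{real_inner, complete_space} \<Rightarrow> ereal"
  assumes "f \<in> Gamma0"
    and "interior (edom (fenchel_conjugate f)) \<noteq> {}"
  shows "(almost_strictly_convex f \<longleftrightarrow>
            (\<forall>u \<in> interior (edom (fenchel_conjugate f)). gateaux_differentiable (fenchel_conjugate f) u) \<and>
            (\<forall>x \<in> - interior (edom (fenchel_conjugate f)). subdifferential (fenchel_conjugate f) x = {})) \<and>
         (almost_strictly_convex f \<longrightarrow>
            dom_subdifferential f =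
              gateaux_gradient (fenchel_conjugate f) ` interior (edom (fenchel_conjugate f)) \<and>
            ran_subdifferential f = interior (edom (fenchel_conjugate f)))"
    (is "(?asc \<longleftrightarrow> ?diff \<and> ?empty) \<and> (?asc \<longrightarrow> ?dom \<and> ?ran)")
proof -
  let ?D = "interior (edom (fenchel_conjugate f))"
  have pr: "proper f" and cvx: "econvex f" using assms(1) by (auto simp: Gamma0_def)
  have ne: "edom (fenchel_conjugate f) \<noteq> {}" using assms(2) interior_subset by fastforce
  note inverse = subdifferential_fenchel_conjugateI[OF pr]
    subdifferential_fenchel_conjugateD[OF assms(1) ne]
  \<comment> \<open>A common subgradient \<open>u\<close> of \<open>f\<close> at \<open>x\<close>
    and \<open>y\<close> makes both points subgradients of the conjugate at \<open>u\<close>.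
    Emptiness off the interior places \<open>u\<close> inside, where the derivative determines the
    subgradient.\<close>
  have "?asc" if "?diff" "?empty"
  proof (rule almost_strictly_convex_if_subgradient_unique[OF pr])
    fix u x y
    assume "u \<in> subdifferential f x" "u \<in> subdifferential f y"
    then have xy: "x \<in> subdifferential (fenchel_conjugate f) u"
        "y \<in> subdifferential (fenchel_conjugate f) u"
      by (auto intro: inverse)
    then have "u \<in> ?D" using \<open>?empty\<close> by blast
    then obtain D where "has_gateaux_derivative (fenchel_conjugate f) D u"
      using \<open>?diff\<close> by (auto simp: gateaux_differentiable_def)
    then have "z \<bullet> x = z \<bullet> y" for z
      using xy has_gateaux_derivative_subgradient_unique by metis
    then show "x = y" using vector_eq_ldot by blast
  qed
  moreover have "?diff \<and> ?empty \<and> ?dom \<and> ?ran" if "?asc"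
  proof -
    note unique = subgradient_unique_if_almost_strictly_convex[OF pr that cvx]
    have interior: "u \<in> ?D" if "u \<in> subdifferential f x" for u x
      using interior_if_subgradient_unique[OF assms that unique[OF that]] .
    have deriv: "has_gateaux_derivative (fenchel_conjugate f) (\<lambda>y. y \<bullet> x) u"
      if "u \<in> subdifferential f x" for u x
      using has_gateaux_derivative_fenchel_conjugate[OF assms(1) interior[OF that] that]
        unique that by blast
    \<comment> \<open>On \<open>?D\<close> the gradient thus inverts the subdifferential of
      \<open>f\<close>; together with \<open>interior\<close> and \<open>ex\<close> this yields both
      formulas.\<close>
    have gradient: "gateaux_gradient (fenchel_conjugate f) u = x"
      if "u \<in> subdifferential f x" for u x
      using deriv[OF that] inverse(1)[OF that] by (rule gateaux_gradient_eqI)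
    have ex: "\<exists>x. u \<in> subdifferential f x" if "u \<in> ?D" for u
      using ex_subgradient_interior_edom_fenchel_conjugate[OF assms(1) that] by blast
    have ?diff using ex deriv by (meson gateaux_differentiable_def)
    moreover have ?empty using interior inverse(2) by blast
    moreover have ?dom
    proof (intro set_eqI iffI)
      fix x assume "x \<in> dom_subdifferential f"
      then obtain u where "u \<in> subdifferential f x" by (auto simp: dom_subdifferential_def)
      then show "x \<in> gateaux_gradient (fenchel_conjugate f) ` ?D"
        using gradient interior by blast
    next
      fix x assume "x \<in> gateaux_gradient (fenchel_conjugate f) ` ?D"
      then obtain u where "u \<in> subdifferential f x" using ex gradient by blast
      then show "x \<in> dom_subdifferential f" by (auto simp: dom_subdifferential_def)
    qed
    moreover have ?ran
      using ex interior unfolding ran_subdifferential_def by blast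
    ultimately show ?thesis by blast
  qed
  ultimately show ?thesis by blast
qed

end
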